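(* Let $k>1$ be an integer. For any word $w$, $N_k(w) \le \frac{|w|-|\mathrm{Alph}(w)|}{k-1}$. Consequently, for any integer $n\ge 1$, $N(n,k)\le \frac{n-1}{k-1}$.
   Context: Words are finite sequences over an arbitrary alphabet; $|w|$ is the length of $w$ and $\mathrm{Alph}(w)$ is the set of letters occurring in $w$. A $k$-power is a word of the form $x^k$ with $x$ a nonempty word. $N_k(w)$ denotes the number of distinct factors (contiguous subwords) of $w$ that are $k$-powers, and $N(n,k)$ is the maximum of $N_k(w)$ over all words $w$ of length $n$. *)

theory Defs
  imports Complex_Main "HOL-Library.Sublist"
begin

definition is_kpower :: "nat \<Rightarrow> 'a list \<Rightarrow> bool" where
  "is_kpower k u \<longleftrightarrow> (\<exists>x. x \<noteq> [] \<and> u = concat (replicate k x))"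

definition kpower_factors :: "nat \<Rightarrow> 'a list \<Rightarrow> 'a list set" where
  "kpower_factors k w = {u. sublist u w \<and> is_kpower k u}"

definition num_kpowers :: "nat \<Rightarrow> 'a list \<Rightarrow> nat" where
  "num_kpowers k w = card (kpower_factors k w)"

text \<open>The alphabet is a type, passed as an explicit argument. There may be infinitely many words of
  length \<open>n\<close>, but the set of values is finite and nonempty (\<open>finite_num_kpowers_values\<close> and
  \<open>num_kpowers_values_nonempty\<close>), so \<open>Max\<close> is a genuine maximum. All infinite alphabets give the
  same value, and it dominates the value for every finite alphabet
  (\<open>num_kpowers_le_max_num_kpowers\<close>).\<close>

definition max_num_kpowers :: "'a itself \<Rightarrow> nat \<Rightarrow> nat \<Rightarrow> nat" where
  "max_num_kpowers A n k = Max {num_kpowers k w | w :: 'a list. length w = n}"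

lemma kpower_factors_subset: "kpower_factors k w \<subseteq> set (sublists w)"
  by (auto simp: kpower_factors_def)

lemma finite_kpower_factors: "finite (kpower_factors k w)"
  using kpower_factors_subset finite_subset by blast

lemma finite_num_kpowers_values:
  "finite {num_kpowers k w | w :: 'a list. length w = n}"
proof (rule finite_subset)
  have "num_kpowers k w \<le> length (sublists w)" for w :: "'a list"
    using card_mono[OF _ kpower_factors_subset[of k w]] card_length[of "sublists w"]
    unfolding num_kpowers_def by fastforce
  then show "{num_kpowers k w | w :: 'a list. length w = n} \<subseteq> {..Suc (n * Suc n div 2)}"
    unfolding length_sublists by blast
qed simp

lemma num_kpowers_values_nonempty:
  "{num_kpowers k w | w :: 'a list. length w = n} \<noteq> {}"
  using length_replicate[of n "undefined :: 'a"] by blast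

lemma num_kpowers_map_inj:
  assumes "inj_on f (set w)"
  shows "num_kpowers k w \<le> num_kpowers k (map f w)"
  unfolding num_kpowers_def
proof (rule card_inj_on_le[where f = "map f"])
  have sub: "kpower_factors k w \<subseteq> lists (set w)"
    by (auto simp: kpower_factors_def dest: set_mono_sublist)
  show "inj_on (map f) (kpower_factors k w)"
    using assms sub by (meson inj_on_map_lists inj_on_subset)
  show "map f ` kpower_factors k w \<subseteq> kpower_factors k (map f w)"
  proof
    fix v assume "v \<in> map f ` kpower_factors k w"
    then obtain x where x: "x \<noteq> []" "v = map f (concat (replicate k x))"
      and "sublist (concat (replicate k x)) w"
      by (auto simp: kpower_factors_def is_kpower_def)
    then have "sublist v (map f w)" by (simp add: map_mono_sublist)
    moreover have "map f x \<noteq> []" "v = concat (replicate k (map f x))"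
      using x by (simp_all add: map_concat)
    ultimately show "v \<in> kpower_factors k (map f w)"
      unfolding kpower_factors_def is_kpower_def by blast
  qed
  show "finite (kpower_factors k (map f w))" by (rule finite_kpower_factors)
qed

lemma num_kpowers_le_max_num_kpowers:
  fixes w :: "'b list"
  assumes "infinite (UNIV :: 'a set)"
  shows "num_kpowers k w \<le> max_num_kpowers TYPE('a) (length w) k"
proof -
  obtain B :: "'a set" where "finite B" "card B = card (set w)"
    using infinite_arbitrarily_large[OF assms] by blast
  then obtain f where "bij_betw f (set w) B"
    using finite_same_card_bij[of "set w" B] by auto
  then have "num_kpowers k w \<le> num_kpowers k (map f w)"
    by (intro num_kpowers_map_inj) (simp add: bij_betw_def)
  also have "\<dots> \<le> max_num_kpowers TYPE('a) (length w) k"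
    unfolding max_num_kpowers_def
    by (rule Max_ge[OF finite_num_kpowers_values]) (metis (mono_tags, lifting) length_map mem_Collect_eq)
  finally show ?thesis .
qed

end

theory Submission
  imports Defs "HOL-Library.List_Lexorder"
begin

text \<open>The Rauzy graph of order \<open>m\<close> of a word \<open>w\<close> has the factors of length \<open>m\<close> as vertices and those of
  length \<open>m + 1\<close> as edges. It is connected, so its cyclomatic number is \<open>C(m+1) - C(m) + 1\<close>, where
  \<open>C\<close> is the factor complexity of \<open>w\<close>; summed over \<open>1 \<le> m \<le> |w|\<close> these numbers telescope to
  \<open>|w| - |Alph(w)|\<close>. A Lyndon word \<open>z\<close> with \<open>|z| \<le> m\<close> such that \<open>w\<close> contains all windows of length \<open>m + 1\<close>
  of \<open>zzz...\<close> gives a circuit of length \<open>|z|\<close>. These circuits are independent: as Lyndon words are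
  unbordered, the window starting with \<open>z\<close> is an edge lying on no shorter circuit. Finally, if \<open>w\<close>
  contains \<open>r\<close> distinct \<open>k\<close>-powers whose primitive roots are conjugates of \<open>z\<close>, then the circuit of
  \<open>z\<close> is present for at least \<open>(k - 1) r\<close> orders \<open>m\<close>.\<close>

section \<open>Windows of periodic words and Lyndon words\<close>

text \<open>The factor of length \<open>m\<close> at position \<open>i\<close> of zzz... Rotations,
  powers of conjugates and edges of Rauzy graphs all have this form, so comparing them is index
  arithmetic modulo \<open>length z\<close>.\<close>

definition periodic_window :: "'a list \<Rightarrow> nat \<Rightarrow> nat \<Rightarrow> 'a list" where
  "periodic_window z m i = map (\<lambda>j. z ! ((i + j) mod length z)) [0..<m]"

text \<open>Strictness excludes proper powers and leaves exactly one such word per conjugacy class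
  of primitive words.\<close>

definition lyndon :: "'a::linorder list \<Rightarrow> bool" where
  "lyndon z \<longleftrightarrow> z \<noteq> [] \<and> (\<forall>i. 0 < i \<and> i < length z \<longrightarrow> z < rotate i z)"

lemma length_periodic_window [simp]: "length (periodic_window z m i) = m"
  by (simp add: periodic_window_def)

lemma nth_periodic_window [simp]:
  "j < m \<Longrightarrow> periodic_window z m i ! j = z ! ((i + j) mod length z)"
  by (simp add: periodic_window_def)

lemma periodic_window_mod: "periodic_window z m (i mod length z) = periodic_window z m i"
  by (rule nth_equalityI) (simp_all add: mod_add_left_eq)

lemma periodic_window_length: "periodic_window z m (length z) = periodic_window z m 0"
  using periodic_window_mod[of z m "length z"] by simp

lemma butlast_periodic_window: "butlast (periodic_window z (Suc m) i) = periodic_window z m i"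
  by (rule nth_equalityI) (simp_all add: nth_butlast)

lemma tl_periodic_window: "tl (periodic_window z (Suc m) i) = periodic_window z m (Suc i)"
  by (rule nth_equalityI) (simp_all add: nth_tl)

lemma take_drop_periodic_window:
  "s + m \<le> l \<Longrightarrow> take m (drop s (periodic_window z l a)) = periodic_window z m (a + s)"
  by (rule nth_equalityI) (simp_all add: add.assoc)

lemma sublist_periodic_window:
  assumes "s + m \<le> l"
  shows "sublist (periodic_window z m (a + s)) (periodic_window z l a)"
  unfolding take_drop_periodic_window[OF assms, symmetric]
  by (meson sublist_drop sublist_order.order_trans sublist_take)

lemma rotate_eq_periodic_window: "rotate i z = periodic_window z (length z) i"
  by (rule nth_equalityI) (simp_all add: nth_rotate add.commute)

lemma eq_periodic_window_0: "z = periodic_window z (length z) 0"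
  using rotate_eq_periodic_window[of 0 z] by simp

lemma nth_concat_replicate:
  assumes "t < k * length x"
  shows "concat (replicate k x) ! t = x ! (t mod length x)"
  using assms
proof (induction k arbitrary: t)
  case (Suc k)
  show ?case
  proof (cases "t < length x")
    case False
    then have "(t - length x) mod length x = t mod length x"
      by (simp add: le_mod_geq)
    then show ?thesis using Suc False by (auto simp: nth_append)
  qed (auto simp: nth_append)
qed simp

lemma length_concat_replicate: "length (concat (replicate k x)) = k * length x"
  by (induction k) auto

lemma concat_replicate_periodic_window:
  "concat (replicate k (periodic_window z (j * length z) i)) = periodic_window z (k * j * length z) i"
proof (rule nth_equalityI)
  fix t assume "t < length (concat (replicate k (periodic_window z (j * length z) i)))"
  then have t: "t < k * (j * length z)" by (simp add: length_concat_replicate)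
  then have "0 < j * length z" by (cases "j * length z") auto
  moreover have "(i + t mod (j * length z)) mod length z = (i + t) mod length z"
    by (metis mod_add_right_eq mod_mult_self2_is_0 mod_mod_cancel dvd_triv_right)
  ultimately show "concat (replicate k (periodic_window z (j * length z) i)) ! t =
      periodic_window z (k * j * length z) i ! t"
    using t by (simp add: nth_concat_replicate mult.assoc)
qed (simp add: length_concat_replicate mult.assoc)

section \<open>Lexicographic order and Lyndon words\<close>

lemma append_less_cancel_left:
  fixes u a b :: "'a::linorder list"
  shows "u @ a < u @ b \<longleftrightarrow> a < b"
  by (induction u) auto

lemma append_less_cancel_right:
  fixes u a b :: "'a::linorder list"
  assumes "a @ u < b @ u" "length a = length b"
  shows "a < b"
  using assms(2,1) by (induction a b rule: list_induct2) auto

text \<open>The border yields two rotations, \<open>v @ u\<close> and \<open>u @ v'\<close>, both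
  above \<open>z\<close>. Cancelling \<open>u\<close> on the right in one comparison and on the left
  in the other orders \<open>v\<close> and \<open>v'\<close> both ways.\<close>

lemma lyndon_unbordered:
  assumes "lyndon z" "z = u @ v" "z = v' @ u" "u \<noteq> []" "v \<noteq> []"
  shows False
proof -
  have len: "length v = length v'" using assms(2,3) by (metis add.commute add_left_cancel length_append)
  have r1: "rotate (length u) z = v @ u" using assms(2) by (simp add: rotate_append)
  have r2: "rotate (length v') z = u @ v'" using assms(3) by (simp add: rotate_append)
  have "z < v @ u" "z < u @ v'"
    using assms len r1 r2 unfolding lyndon_def
    by (metis length_append length_greater_0_conv less_add_same_cancel1 add.commute)+
  then have "v' < v" "v < v'"
    using assms(2,3) len append_less_cancel_right[of v' u v] append_less_cancel_left[of u v v'] by auto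
  then show False by simp
qed

text \<open>A period \<open>p\<close> makes the prefix of length \<open>length z - p\<close> a
  suffix as well, that is, a border.\<close>

lemma lyndon_no_short_period:
  assumes "lyndon z" "0 < p" "p < length z"
    and "\<And>t. t + p < length z \<Longrightarrow> z ! (t + p) = z ! t"
  shows False
proof (rule lyndon_unbordered[OF assms(1), of "take (length z - p) z" "drop (length z - p) z" "take p z"])
  have "drop p z = take (length z - p) z"
    by (rule nth_equalityI) (use assms in \<open>simp_all add: add.commute\<close>)
  then show "z = take p z @ take (length z - p) z" by (metis append_take_drop_id)
  show "z = take (length z - p) z @ drop (length z - p) z" by simp
qed (use assms in auto)

text \<open>The word \<open>z'\<close> is read along zzz... from position \<open>i\<close>. If
  longer than \<open>z\<close>, it would inherit the period \<open>length z\<close>; if equally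
  long, it is a rotation of \<open>z\<close>, and strict minimality of both leaves only the trivial
  one.\<close>

lemma lyndon_window_on_circuit:
  assumes z: "lyndon z" "lyndon z'" and m: "length z \<le> m" "length z' \<le> m"
    and eq: "periodic_window z' m 0 = periodic_window z m i" and i: "i < length z"
  shows "length z' < length z \<or> (z' = z \<and> i = 0)"
proof -
  have nth: "z' ! t = z ! ((i + t) mod length z)" if "t < length z'" for t
    using arg_cong[OF eq, of "\<lambda>x. x ! t"] that m by simp
  have pos: "0 < length z" using z by (simp add: lyndon_def)
  consider "length z < length z'" | "length z' < length z" | "length z' = length z" by linarith
  then show ?thesis
  proof cases
    case 1
    have "z' ! (t + length z) = z' ! t" if "t + length z < length z'" for t
      using nth[of t] nth[of "t + length z"] that
      by (metis add.assoc add_lessD1 mod_add_self2)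
    then show ?thesis using lyndon_no_short_period[OF z(2) pos 1] by blast
  next
    case 3
    have rot: "z' = rotate i z"
      unfolding rotate_eq_periodic_window by (rule nth_equalityI) (use 3 nth in auto)
    show ?thesis
    proof (cases "i = 0")
      case False
      have "rotate (length z - i) z' = z"
        using rot i by (simp add: rotate_rotate)
      moreover have "z' < rotate (length z - i) z'" "z < rotate i z"
        using z False i 3 unfolding lyndon_def by auto
      ultimately show ?thesis using rot by auto
    qed (use rot in auto)
  qed auto
qed

text \<open>Pass to the least rotation \<open>y\<close>. If \<open>y\<close> is not Lyndon, a
  nontrivial rotation fixes it, so it splits into commuting words and is a power of a shorter word,
  to which induction applies.\<close>

lemma lyndon_root:
  fixes x :: "'a::linorder list"
  assumes "x \<noteq> []"
  shows "\<exists>z j i. lyndon z \<and> 0 < j \<and> i < length z \<and> x = periodic_window z (j * length z) i"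
  using assms
proof (induction "length x" arbitrary: x rule: less_induct)
  case less
  define S where "S = (\<lambda>i. rotate i x) ` {..<length x}"
  define y where "y = Min S"
  have S: "finite S" "S \<noteq> {}" using less.prems by (auto simp: S_def)
  then have "y \<in> S" unfolding y_def by (rule Min_in)
  then obtain a where a: "a < length x" "y = rotate a x" by (auto simp: S_def)
  have len: "length y = length x" using a by simp
  have min: "y \<le> rotate i y" for i
  proof -
    have "rotate i y = rotate ((i + a) mod length x) x"
      using a by (metis rotate_conv_mod rotate_rotate)
    moreover have "(i + a) mod length x < length x" using less.prems by simp
    ultimately have "rotate i y \<in> S" by (auto simp: S_def)
    then show ?thesis unfolding y_def using S by simp
  qed
  have x: "x = rotate (length x - a) y" using a by (simp add: rotate_rotate)
  have "\<exists>z j i. lyndon z \<and> 0 < j \<and> i < length z \<and> y = periodic_window z (j * length z) i"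
  proof (cases "lyndon y")
    case True
    then show ?thesis using eq_periodic_window_0[of y]
      by (intro exI[of _ y] exI[of _ 1] exI[of _ 0]) (auto simp: lyndon_def)
  next
    case False
    then obtain i where i: "0 < i" "i < length y" "\<not> y < rotate i y"
      using less.prems len by (auto simp: lyndon_def)
    then have "rotate i y = y" using min[of i] by simp
    then have "drop i y @ take i y = take i y @ drop i y"
      using i by (simp add: rotate_drop_take)
    then obtain c d t where t: "concat (replicate c t) = drop i y" "concat (replicate d t) = take i y"
      using comm_append_are_replicate by blast
    have c: "c > 0" "d > 0" "t \<noteq> []" using t i by (auto intro!: gr0I)
    have "y = concat (replicate (d + c) t)"
      using t by (metis append_take_drop_id concat_append replicate_add)
    moreover have "length t < length x"
    proof -
      have "length t \<le> length (take i y)" unfolding t(2)[symmetric] length_concat_replicate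
        using c by simp
      then show ?thesis using i len by simp
    qed
    ultimately show ?thesis
      using less.hyps[of t] c concat_replicate_periodic_window
      by (metis add_gr_0 mult_pos_pos)
  qed
  then obtain z j i where z: "lyndon z" "0 < j" "i < length z" "y = periodic_window z (j * length z) i"
    by blast
  \<comment> \<open>Rotating \<open>y\<close> back adds \<open>length x - a\<close> to the shift;
    wrapping modulo \<open>length x\<close>, a multiple of \<open>length z\<close>, preserves the
    residue modulo \<open>length z\<close>.\<close>
  have "x = periodic_window z (j * length z) ((i + (length x - a)) mod length z)"
    unfolding periodic_window_mod
  proof (rule nth_equalityI)
    fix t assume "t < length x"
    define q where "q = j * length z"
    have q: "length x = q" using z len by (simp add: q_def)
    have "q > 0" using q less.prems by auto
    have "x ! t = y ! ((length x - a + t) mod q)"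
      using x \<open>t < length x\<close> by (metis len nth_rotate q)
    also have "\<dots> = z ! ((i + (length x - a + t) mod q) mod length z)"
      using z \<open>q > 0\<close> by (simp add: q_def)
    also have "(i + (length x - a + t) mod q) mod length z = (i + (length x - a + t)) mod length z"
      unfolding q_def by (metis mod_add_right_eq mod_mod_cancel dvd_triv_right)
    finally show "x ! t = periodic_window z (j * length z) (i + (length x - a)) ! t"
      using \<open>t < length x\<close> q by (simp add: q_def add.assoc)
  qed (use z len in simp)
  moreover have "(i + (length x - a)) mod length z < length z"
    using z by (simp add: lyndon_def)
  ultimately show ?case using z by blast
qed

section \<open>Circuits in Rauzy graphs\<close>

definition factors :: "'a list \<Rightarrow> nat \<Rightarrow> 'a list set" where
  "factors w m = {u. sublist u w \<and> length u = m}"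

text \<open>The vertices of the Rauzy graph of order \<open>m\<close> are \<open>factors w m\<close>; an edge \<open>u\<close> of length
  \<open>m + 1\<close> joins \<open>butlast u\<close> to \<open>tl u\<close>. Orientation is forgotten.\<close>

definition rauzy_connected :: "'a list set \<Rightarrow> ('a list \<times> 'a list) set" where
  "rauzy_connected E = ((\<lambda>u. (butlast u, tl u)) ` E \<union> (\<lambda>u. (tl u, butlast u)) ` E)\<^sup>*"

text \<open>A circuit is represented by its Lyndon word; \<open>length z \<le> m\<close> makes every
  vertex on it show a full period.\<close>

definition circuits :: "'a::linorder list \<Rightarrow> nat \<Rightarrow> 'a list set" where
  "circuits w m = {z. lyndon z \<and> length z \<le> m \<and>
     (\<forall>i<length z. periodic_window z (Suc m) i \<in> factors w (Suc m))}"

lemma finite_factors: "finite (factors w m)"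
  by (rule finite_subset[of _ "set (sublists w)"]) (auto simp: factors_def)

lemma factors_sublist: "u \<in> factors w l \<Longrightarrow> sublist v u \<Longrightarrow> length v = m \<Longrightarrow> v \<in> factors w m"
  unfolding factors_def using sublist_order.order_trans by blast

lemma rauzy_connected_edge: "u \<in> E \<Longrightarrow> (butlast u, tl u) \<in> rauzy_connected E"
  unfolding rauzy_connected_def by blast

lemma rauzy_connected_trans:
  "(a, b) \<in> rauzy_connected E \<Longrightarrow> (b, c) \<in> rauzy_connected E \<Longrightarrow> (a, c) \<in> rauzy_connected E"
  unfolding rauzy_connected_def by (rule rtrancl_trans)

lemma rauzy_connected_refl: "(a, a) \<in> rauzy_connected E"
  unfolding rauzy_connected_def by simp

lemma rauzy_connected_sym: "(a, b) \<in> rauzy_connected E \<Longrightarrow> (b, a) \<in> rauzy_connected E"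
proof -
  have "sym ((\<lambda>u. (butlast u, tl u)) ` E \<union> (\<lambda>u. (tl u, butlast u)) ` E)"
    by (auto simp: sym_def)
  then show "(a, b) \<in> rauzy_connected E \<Longrightarrow> (b, a) \<in> rauzy_connected E"
    unfolding rauzy_connected_def by (meson sym_rtrancl symD)
qed

text \<open>Spanning tree bound: grow a vertex set from \<open>a\<close>. By connectedness some edge
  leaves it, and adding the outer end gains one vertex and at least one inner edge.\<close>

lemma rauzy_connected_card:
  assumes fin: "finite V" "finite E" and a: "a \<in> V"
    and conn: "\<And>v. v \<in> V \<Longrightarrow> (a, v) \<in> rauzy_connected E"
    and ends: "\<And>u. u \<in> E \<Longrightarrow> butlast u \<in> V \<and> tl u \<in> V"
  shows "card V \<le> card E + 1"
proof -
  define In where "In S = {u \<in> E. butlast u \<in> S \<and> tl u \<in> S}" for S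
  have "\<exists>S\<subseteq>V. a \<in> S \<and> card S = Suc n \<and> card S \<le> card (In S) + 1" if "n < card V" for n
    using that
  proof (induction n)
    case 0
    show ?case using a by (intro exI[of _ "{a}"]) auto
  next
    case (Suc n)
    then obtain S where S: "S \<subseteq> V" "a \<in> S" "card S = Suc n" "card S \<le> card (In S) + 1"
      by auto
    have "S \<noteq> V" using S Suc.prems by auto
    then obtain v where v: "v \<in> V" "v \<notin> S" using S by auto
    have "\<exists>u\<in>E. (butlast u \<in> S) \<noteq> (tl u \<in> S)"
    proof (rule ccontr)
      assume no: "\<not> (\<exists>u\<in>E. (butlast u \<in> S) \<noteq> (tl u \<in> S))"
      have "x \<in> S" if "(a, x) \<in> rauzy_connected E" for x
        using that unfolding rauzy_connected_def
        by (induction rule: rtrancl_induct) (use S no in auto)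
      then show False using conn v by blast
    qed
    then obtain u where u: "u \<in> E" "(butlast u \<in> S) \<noteq> (tl u \<in> S)" by blast
    then obtain y where y: "y \<in> V" "y \<notin> S" "butlast u \<in> insert y S" "tl u \<in> insert y S"
      using ends by blast
    have finS: "finite S" using S fin finite_subset by blast
    have "insert u (In S) \<subseteq> In (insert y S)" using u y by (auto simp: In_def)
    moreover have "u \<notin> In S" using u by (auto simp: In_def)
    moreover have "finite (In T)" for T using fin by (simp add: In_def)
    ultimately have "card (In S) + 1 \<le> card (In (insert y S))"
      by (metis card_insert_disjoint card_mono Suc_eq_plus1)
    then show ?case using S y finS by (intro exI[of _ "insert y S"]) auto
  qed
  from this[of "card V - 1"] obtain S where "S \<subseteq> V" "card S = card V" "card S \<le> card (In S) + 1"
    using a fin card_gt_0_iff by (metis One_nat_def Suc_pred diff_less empty_iff zero_less_one)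
  moreover have "card (In S) \<le> card E" using fin by (intro card_mono) (auto simp: In_def)
  ultimately show ?thesis by linarith
qed

text \<open>Sliding a window of length \<open>m\<close> along \<open>w\<close> is a walk from the
  prefix of \<open>w\<close> through all vertices.\<close>

lemma factors_rauzy_connected:
  assumes "v \<in> factors w m"
  shows "(take m w, v) \<in> rauzy_connected (factors w (Suc m))"
proof -
  obtain p s where w: "w = p @ v @ s" and v: "length v = m"
    using assms by (auto simp: factors_def sublist_def)
  have "(take m w, take m (drop i w)) \<in> rauzy_connected (factors w (Suc m))"
    if "i + m \<le> length w" for i
    using that
  proof (induction i)
    case 0
    show ?case by (simp add: rauzy_connected_refl)
  next
    case (Suc i)
    let ?u = "take (Suc m) (drop i w)"
    have "?u \<in> factors w (Suc m)"
      using Suc.prems by (auto simp: factors_def intro: sublist_order.order_trans)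
    moreover have "butlast ?u = take m (drop i w)"
      using Suc.prems by (simp add: butlast_take)
    moreover have "tl ?u = take m (drop (Suc i) w)"
      by (simp add: drop_Suc tl_drop tl_take)
    ultimately show ?case
      using Suc rauzy_connected_trans rauzy_connected_edge by (metis add_Suc Suc_leD)
  qed
  from this[of "length p"] show ?thesis using w v by simp
qed

text \<open>Each circuit loses the edge starting with its Lyndon word. Since that edge lies on no shorter circuit, the rest of
  the circuit still joins its ends, by induction on the length of the circuit.\<close>

lemma circuit_edge_redundant:
  fixes w :: "'a::linorder list"
  defines "E' m \<equiv> factors w (Suc m) - (\<lambda>z. periodic_window z (Suc m) 0) ` circuits w m"
  assumes "z \<in> circuits w m"
  shows "(periodic_window z m 0, periodic_window z m 1) \<in> rauzy_connected (E' m)"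
  using assms(2)
proof (induction "length z" arbitrary: z rule: less_induct)
  case less
  have z: "lyndon z" "length z \<le> m"
    "\<And>i. i < length z \<Longrightarrow> periodic_window z (Suc m) i \<in> factors w (Suc m)"
    using less.prems by (auto simp: circuits_def)
  have edge: "(periodic_window z m i, periodic_window z m (Suc i)) \<in> rauzy_connected (E' m)"
    if i: "0 < i" "i < length z" for i
  proof (cases "periodic_window z (Suc m) i \<in> E' m")
    case True
    then show ?thesis using rauzy_connected_edge butlast_periodic_window tl_periodic_window by metis
  next
    case False
    then obtain z' where z': "z' \<in> circuits w m"
      and eq: "periodic_window z' (Suc m) 0 = periodic_window z (Suc m) i"
      using z(3) i by (auto simp: E'_def)
    \<comment> \<open>Since \<open>0 < i\<close>, the alternative \<open>z' = z\<close> is excluded;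
      the missing edge is then bypassed by the induction hypothesis for the shorter
      \<open>z'\<close>.\<close>
    have "length z' < length z"
      using lyndon_window_on_circuit[OF z(1) _ _ _ eq] i z z' by (auto simp: circuits_def)
    moreover have "periodic_window z' m 0 = periodic_window z m i"
      "periodic_window z' m 1 = periodic_window z m (Suc i)"
      using arg_cong[OF eq, of butlast] arg_cong[OF eq, of tl]
      by (simp_all add: butlast_periodic_window tl_periodic_window)
    ultimately show ?thesis using less.hyps z' by metis
  qed
  \<comment> \<open>The edges of shifts 1 to \<open>length z - 1\<close> go round the circuit the
    other way and avoid the removed edge of shift 0.\<close>
  have "(periodic_window z m 1, periodic_window z m (Suc i)) \<in> rauzy_connected (E' m)"
    if "i < length z" for i
    using that
  proof (induction i)
    case (Suc i)
    then show ?case using edge[of "Suc i"] rauzy_connected_trans by fastforce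
  qed (simp add: rauzy_connected_refl)
  from this[of "length z - 1"]
  have "(periodic_window z m 1, periodic_window z m (length z)) \<in> rauzy_connected (E' m)"
    using z(1) by (simp add: lyndon_def)
  then show ?case by (simp add: periodic_window_length rauzy_connected_sym)
qed

text \<open>Deleting one edge per circuit keeps the graph connected, so the tree bound holds for the
  remaining edges. Different circuits lose different edges: otherwise each Lyndon word would be
  shorter than the other.\<close>

lemma card_circuits_le:
  fixes w :: "'a::linorder list"
  assumes "m \<le> length w"
  shows "card (factors w m) + card (circuits w m) \<le> card (factors w (Suc m)) + 1"
proof -
  define e where "e z = periodic_window z (Suc m) 0" for z :: "'a list"
  define E where "E = factors w (Suc m) - e ` circuits w m"
  have redundant: "(butlast u, tl u) \<in> rauzy_connected E" if u: "u \<in> factors w (Suc m)" for u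
  proof (cases "u \<in> E")
    case False
    then obtain z where "z \<in> circuits w m" "u = periodic_window z (Suc m) 0"
      using u by (auto simp: E_def e_def)
    then show ?thesis
      using circuit_edge_redundant[of z w m]
      by (simp add: butlast_periodic_window tl_periodic_window E_def e_def)
  qed (rule rauzy_connected_edge)
  have subset: "x \<in> rauzy_connected E" if "x \<in> rauzy_connected (factors w (Suc m))" for x
  proof -
    obtain a b where x: "x = (a, b)" by (cases x)
    have "(a, b) \<in> rauzy_connected E"
      using that unfolding x rauzy_connected_def[of "factors w (Suc m)"]
    proof (induction rule: rtrancl_induct)
      case (step y z)
      then show ?case using redundant rauzy_connected_sym rauzy_connected_trans by blast
    qed (rule rauzy_connected_refl)
    then show ?thesis using x by simp
  qed
  have "card (factors w m) \<le> card E + 1"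
  proof (rule rauzy_connected_card[of _ _ "take m w"])
    show "take m w \<in> factors w m" using assms by (simp add: factors_def)
    show "(take m w, v) \<in> rauzy_connected E" if "v \<in> factors w m" for v
      using that factors_rauzy_connected subset by blast
    show "butlast u \<in> factors w m \<and> tl u \<in> factors w m" if "u \<in> E" for u
    proof -
      have "u \<in> factors w (Suc m)" using that by (simp add: E_def)
      then show ?thesis
        using factors_sublist[of u w "Suc m"] by (simp add: factors_def)
    qed
  qed (simp_all add: finite_factors E_def)
  moreover have "card E = card (factors w (Suc m)) - card (circuits w m)"
    and "card (circuits w m) \<le> card (factors w (Suc m))"
  proof -
    have "inj_on e (circuits w m)"
    proof (rule inj_onI)
      fix x y assume xy: "x \<in> circuits w m" "y \<in> circuits w m" and "e x = e y"
      then have eq: "periodic_window x (Suc m) 0 = periodic_window y (Suc m) 0"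
        by (simp add: e_def)
      show "x = y"
        using xy lyndon_window_on_circuit[OF _ _ _ _ eq] lyndon_window_on_circuit[OF _ _ _ _ eq[symmetric]]
        by (fastforce simp: circuits_def lyndon_def)
    qed
    moreover have "e ` circuits w m \<subseteq> factors w (Suc m)"
      by (auto simp: e_def circuits_def lyndon_def)
    ultimately show "card E = card (factors w (Suc m)) - card (circuits w m)"
      "card (circuits w m) \<le> card (factors w (Suc m))"
      unfolding E_def using finite_factors
      by (metis card_Diff_subset card_image finite_subset, metis card_inj_on_le)
  qed
  ultimately show ?thesis by linarith
qed

lemma factors_1: "card (factors w 1) = card (set w)"
proof -
  have "factors w 1 = (\<lambda>a. [a]) ` set w"
    by (fastforce simp: factors_def length_Suc_conv sublist_def dest: split_list)
  then show ?thesis by (simp add: card_image inj_on_def)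
qed

text \<open>Telescoping runs from \<open>m = 1\<close>, where the factors are the letters, to
  \<open>length w + 1\<close>, where there are none; each order contributes 1 to the bound.\<close>

lemma sum_card_circuits_le:
  fixes w :: "'a::linorder list"
  shows "card (set w) + (\<Sum>m=1..length w. card (circuits w m)) \<le> length w"
proof -
  have "card (factors w 1) + (\<Sum>m=1..n. card (circuits w m)) \<le> card (factors w (Suc n)) + n"
    if "n \<le> length w" for n
    using that
  proof (induction n)
    case (Suc n)
    then show ?case using card_circuits_le[of "Suc n" w] by simp
  qed simp
  moreover have "factors w (Suc (length w)) = {}"
    by (auto simp: factors_def dest: sublist_length_le)
  ultimately show ?thesis using factors_1[of w] by fastforce
qed

section \<open>Counting powers with a given root\<close>

text \<open>Pigeonhole: the \<open>t + 1\<close> residues ending at \<open>i\<close> and the set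
  \<open>A\<close> have together more than \<open>p\<close> elements. For \<open>p \<le> t\<close>
  any single \<open>a\<close> already reaches \<open>i\<close>.\<close>

lemma residue_interval_meets:
  fixes A :: "nat set"
  assumes "A \<subseteq> {..<p}" "p \<le> card A + t" "i < p" "A \<noteq> {}"
  shows "\<exists>a\<in>A. \<exists>s\<le>t. (a + s) mod p = i"
proof (cases "p \<le> t")
  case True
  obtain a where a: "a \<in> A" using assms by blast
  then have ap: "a < p" using assms by blast
  have "(a + (i + p - a) mod p) mod p = i"
    using ap assms by (simp add: mod_add_right_eq)
  moreover have "(i + p - a) mod p \<le> t"
    using True ap mod_less_divisor[of p "i + p - a"] by linarith
  ultimately show ?thesis using a by blast
next
  case False
  \<comment> \<open>The summand \<open>p\<close> keeps the natural subtraction from truncating, as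
    \<open>s \<le> t < p\<close>.\<close>
  define B where "B = (\<lambda>s. (i + p - s) mod p) ` {..t}"
  have shift_back: "((i + p - s) mod p + s) mod p = i" if "s \<le> t" for s
    using that False assms(3) by (simp add: mod_add_left_eq)
  have "inj_on (\<lambda>s. (i + p - s) mod p) {..t}"
  proof (rule linorder_inj_onI)
    fix s s' assume s: "s < s'" "s \<in> {..t}" "s' \<in> {..t}"
    show "(i + p - s) mod p \<noteq> (i + p - s') mod p"
    proof
      assume "(i + p - s) mod p = (i + p - s') mod p"
      then have "p dvd (i + p - s) - (i + p - s')" using s by (simp add: mod_eq_dvd_iff_nat)
      moreover have "(i + p - s) - (i + p - s') = s' - s" using s False by simp
      ultimately show False using s False by (auto dest: dvd_imp_le)
    qed
  qed auto
  then have cB: "card B = t + 1" unfolding B_def by (simp add: card_image)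
  have "A \<inter> B \<noteq> {}"
  proof
    assume "A \<inter> B = {}"
    moreover have fin: "finite A" "finite B" using assms(1) finite_subset by (auto simp: B_def)
    moreover have "A \<union> B \<subseteq> {..<p}" using assms by (auto simp: B_def)
    ultimately have "card A + card B \<le> p"
      by (metis card_Un_disjoint card_lessThan card_mono finite_lessThan)
    then show False using cB assms(2) by linarith
  qed
  then obtain s where "s \<le> t" "(i + p - s) mod p \<in> A" by (auto simp: B_def)
  then show ?thesis using shift_back by blast
qed

definition power_shifts :: "nat \<Rightarrow> 'a list \<Rightarrow> 'a list \<Rightarrow> nat \<Rightarrow> nat set" where
  "power_shifts k w z j = {i. i < length z \<and> sublist (periodic_window z (k * j * length z) i) w}"

lemma card_power_shifts_le: "card (power_shifts k w z j) \<le> length z"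
  by (rule order_trans[OF card_mono[of "{..<length z}"]]) (auto simp: power_shifts_def)

text \<open>Let \<open>J\<close> be the largest \<open>j\<close> such that \<open>w\<close> contains a conjugate of \<open>z\<close> to the power \<open>kj\<close>. The \<open>c\<close> shifts
  occurring for \<open>J\<close> complete the circuit of \<open>z\<close> for every order up to \<open>kJ|z| + c - |z| - 1\<close>.\<close>

lemma power_shifts_le_circuit_levels:
  fixes w :: "'a::linorder list"
  assumes "k > 1" and z: "lyndon z"
  shows "(k - 1) * (\<Sum>j=1..length w. card (power_shifts k w z j))
    \<le> card {m \<in> {1..length w}. z \<in> circuits w m}"
proof (cases "\<exists>j\<in>{1..length w}. power_shifts k w z j \<noteq> {}")
  case False
  then show ?thesis by simp
next
  case True
  define p where "p = length z"
  have p: "p > 0" using z by (simp add: p_def lyndon_def)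
  define J where "J = Max {j \<in> {1..length w}. power_shifts k w z j \<noteq> {}}"
  have "J \<in> {j \<in> {1..length w}. power_shifts k w z j \<noteq> {}}"
    unfolding J_def using True by (intro Max_in) auto
  then have J: "1 \<le> J" "J \<le> length w" "power_shifts k w z J \<noteq> {}" by auto
  have above: "power_shifts k w z j = {}" if "j \<in> {1..length w}" "J < j" for j
    using that Max_ge[of "{j \<in> {1..length w}. power_shifts k w z j \<noteq> {}}" j]
    unfolding J_def by fastforce
  define A where "A = power_shifts k w z J"
  define c where "c = card A"
  have A: "A \<subseteq> {..<p}" "A \<noteq> {}" using J by (auto simp: A_def power_shifts_def p_def)
  have c: "1 \<le> c" "c \<le> p"
    using A finite_subset[OF A(1)] card_power_shifts_le[of k w z J]
    by (auto simp: c_def A_def p_def Suc_le_eq card_gt_0_iff)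
  define l where "l = k * J * p"
  have l: "2 * p \<le> l" using assms(1) J(1) mult_le_mono[of 2 k 1 J] by (simp add: l_def)
  have "(\<Sum>j=1..length w. card (power_shifts k w z j)) = (\<Sum>j=1..J. card (power_shifts k w z j))"
    using J above by (intro sum.mono_neutral_right) auto
  also have "\<dots> = (\<Sum>j=1..<J. card (power_shifts k w z j)) + c"
    using J(1) by (simp add: c_def A_def sum.last_plus)
  \<comment> \<open>Each exponent below \<open>J\<close> allows at most \<open>p\<close> shifts;
    only the top count \<open>c\<close> is kept exact.\<close>
  also have "\<dots> \<le> (J - 1) * p + c"
    using sum_bounded_above[of "{1..<J}" "\<lambda>j. card (power_shifts k w z j)" p] card_power_shifts_le[of k w z]
    by (simp add: p_def)
  finally have "(k - 1) * (\<Sum>j=1..length w. card (power_shifts k w z j)) \<le> (k - 1) * ((J - 1) * p + c)"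
    by simp
  \<comment> \<open>With \<open>k = k' + 2\<close> and \<open>J = J' + 1\<close> the right side
    exceeds the left by \<open>J' * p + k' * (p - c)\<close>.\<close>
  also have "\<dots> \<le> l + c - 2 * p"
  proof -
    obtain k' J' where kJ: "k = k' + 2" "J = Suc J'"
      using assms(1) J(1) by (metis Suc_le_D One_nat_def add.commute le_Suc_ex Suc_1 Suc_leI)
    have "c * k' \<le> J' * p + k' * p" using c by (simp add: mult.commute trans_le_add2)
    then show ?thesis unfolding l_def kJ by (simp add: algebra_simps del: mult_le_cancel1 mult_le_cancel2)
  qed
  \<comment> \<open>These are the orders carrying the circuit, from \<open>p\<close>, the least that
    \<open>circuits\<close> admits for \<open>z\<close>.\<close>
  also have "\<dots> = card {p..<l + c - p}" by simp
  also have "\<dots> \<le> card {m \<in> {1..length w}. z \<in> circuits w m}"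
  proof (rule card_mono)
    have lw: "l \<le> length w"
    proof -
      obtain a where "a \<in> A" using A by blast
      then show ?thesis
        using sublist_length_le by (fastforce simp: A_def power_shifts_def l_def p_def)
    qed
    show "{p..<l + c - p} \<subseteq> {m \<in> {1..length w}. z \<in> circuits w m}"
    proof
      fix m assume m: "m \<in> {p..<l + c - p}"
      then have ml: "m < l" "1 \<le> m" using c p by auto
      have "periodic_window z (Suc m) i \<in> factors w (Suc m)" if i: "i < length z" for i
      proof -
        \<comment> \<open>An occurrence of length \<open>l\<close> at shift \<open>a\<close>
          contains the windows of length \<open>m + 1\<close> at shifts \<open>a\<close> to
          \<open>a + (l - m - 1)\<close>; with \<open>c\<close> starting shifts these meet every
          residue.\<close>
        have "p \<le> card A + (l - m - 1)" using m c l by (auto simp: c_def[symmetric])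
        then obtain a s where as: "a \<in> A" "s \<le> l - m - 1" "(a + s) mod p = i"
          using residue_interval_meets[OF A(1) _ _ A(2)] i by (metis p_def)
        have "sublist (periodic_window z (Suc m) (a + s)) (periodic_window z l a)"
          using as ml by (intro sublist_periodic_window) auto
        moreover have "periodic_window z l a \<in> factors w l"
          using as by (simp add: A_def power_shifts_def factors_def l_def p_def)
        moreover have "periodic_window z (Suc m) (a + s) = periodic_window z (Suc m) i"
          using as periodic_window_mod[of z "Suc m" "a + s"] by (simp add: p_def)
        ultimately show ?thesis using factors_sublist by fastforce
      qed
      then show "m \<in> {m \<in> {1..length w}. z \<in> circuits w m}"
        using m ml lw p z by (simp add: circuits_def p_def)
    qed
  qed simp
  finally show ?thesis .
qed

section \<open>Summation over Lyndon roots and orders\<close>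

lemma num_kpowers_linorder:
  fixes w :: "'a::linorder list"
  assumes "k > 1"
  shows "(k - 1) * num_kpowers k w + card (set w) \<le> length w"
proof -
  define L where "L = {z. lyndon z \<and> sublist z w}"
  have finL: "finite L" by (rule finite_subset[of _ "set (sublists w)"]) (auto simp: L_def)
  \<comment> \<open>Triples of root, exponent and shift index the powers; mapping onto all of them
    suffices for an upper bound.\<close>
  define T where "T = (SIGMA z:L. SIGMA j:{1..length w}. power_shifts k w z j)"
  have fin: "finite (power_shifts k w z j)" for z j by (simp add: power_shifts_def)
  have "kpower_factors k w \<subseteq> (\<lambda>(z, j, i). periodic_window z (k * j * length z) i) ` T"
  proof
    fix u assume "u \<in> kpower_factors k w"
    then obtain x where u: "sublist u w" "x \<noteq> []" "u = concat (replicate k x)"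
      by (auto simp: kpower_factors_def is_kpower_def)
    obtain z j i where z: "lyndon z" "0 < j" "i < length z" "x = periodic_window z (j * length z) i"
      using lyndon_root[OF u(2)] by blast
    have uz: "u = periodic_window z (k * j * length z) i"
      using u z concat_replicate_periodic_window by simp
    \<comment> \<open>As \<open>k\<close> is at least 2, the power has length at least twice that of
      \<open>z\<close>, so it contains \<open>z\<close> itself, read from position
      \<open>length z - i\<close>.\<close>
    have kj: "2 * length z \<le> k * j * length z"
      using assms z(2) mult_le_mono[of 2 k 1 j] by simp
    then have "sublist (periodic_window z (length z) (i + (length z - i))) u"
      unfolding uz using z(3) by (intro sublist_periodic_window) linarith
    then have "sublist z u"
      using z(3) by (simp add: periodic_window_length eq_periodic_window_0[symmetric])
    then have "z \<in> L" using z(1) u(1) sublist_order.order_trans by (auto simp: L_def)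
    moreover have "j \<le> length w"
    proof -
      have "j \<le> k * j * length z" using assms z(2,3) by simp
      also have "\<dots> \<le> length w" using sublist_length_le[OF u(1)] uz by simp
      finally show ?thesis .
    qed
    ultimately have "(z, j, i) \<in> T" using z u(1) uz by (auto simp: T_def power_shifts_def)
    then show "u \<in> (\<lambda>(z, j, i). periodic_window z (k * j * length z) i) ` T"
      using uz by force
  qed
  moreover have "finite T" unfolding T_def using finL fin by auto
  ultimately have "num_kpowers k w \<le> card T"
    unfolding num_kpowers_def by (rule surj_card_le[rotated])
  also have "card T = (\<Sum>z\<in>L. \<Sum>j=1..length w. card (power_shifts k w z j))"
    unfolding T_def using finL fin by simp
  finally have "(k - 1) * num_kpowers k w \<le>
      (\<Sum>z\<in>L. (k - 1) * (\<Sum>j=1..length w. card (power_shifts k w z j)))"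
    by (simp add: sum_distrib_left[symmetric])
  also have "\<dots> \<le> (\<Sum>z\<in>L. card {m \<in> {1..length w}. z \<in> circuits w m})"
    by (intro sum_mono power_shifts_le_circuit_levels[OF assms]) (simp add: L_def)
  \<comment> \<open>Double counting of the pairs of a root and an order at which its circuit is
    present.\<close>
  also have "\<dots> = (\<Sum>m=1..length w. card {z \<in> L. z \<in> circuits w m})"
    by (rule sum_multicount_gen) (use finL in auto)
  also have "\<dots> \<le> (\<Sum>m=1..length w. card (circuits w m))"
  proof (intro sum_mono card_mono)
    fix m
    show "finite (circuits w m)"
    proof (rule finite_subset[OF _ finL], rule subsetI)
      fix z assume z: "z \<in> circuits w m"
      then have "periodic_window z (Suc m) 0 \<in> factors w (Suc m)" "length z \<le> m"
        by (auto simp: circuits_def lyndon_def)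
      then have "periodic_window z (length z) 0 \<in> factors w (length z)"
        using factors_sublist sublist_periodic_window[of 0 "length z" "Suc m" z 0] by fastforce
      then show "z \<in> L" using z by (simp add: eq_periodic_window_0[symmetric] factors_def L_def circuits_def)
    qed
  qed auto
  finally show ?thesis using sum_card_circuits_le[of w] by linarith
qed

text \<open>Lyndon words require ordered letters. Encoding the finitely many letters of
  \<open>w\<close> injectively as naturals keeps length and alphabet size and loses no
  powers.\<close>

lemma num_kpowers_bound:
  fixes w :: "'a list"
  assumes "k > 1"
  shows "real (num_kpowers k w) \<le> (real (length w) - real (card (set w))) / (real k - 1)"
proof -
  obtain f :: "'a \<Rightarrow> nat" where f: "inj_on f (set w)"
    using finite_imp_inj_to_nat_seg[of "set w"] by auto
  have "(k - 1) * num_kpowers k w \<le> (k - 1) * num_kpowers k (map f w)"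
    using num_kpowers_map_inj[OF f] by simp
  moreover have "card (set (map f w)) = card (set w)" using f by (simp add: card_image)
  ultimately have "(k - 1) * num_kpowers k w + card (set w) \<le> length w"
    using num_kpowers_linorder[OF assms, of "map f w"] unfolding length_map by linarith
  then have "real ((k - 1) * num_kpowers k w) + real (card (set w)) \<le> real (length w)"
    by (metis of_nat_add of_nat_le_iff)
  moreover have "real (k - 1) = real k - 1" using assms by simp
  ultimately show ?thesis using assms by (simp add: field_simps)
qed

theorem mainTheorem2:
  fixes k :: nat
  assumes "k > 1"
  shows "(\<forall>w :: 'a list. real (num_kpowers k w)
            \<le> (real (length w) - real (card (set w))) / (real k - 1))
       \<and> (\<forall>n\<ge>1. real (max_num_kpowers TYPE('b) n k) \<le> (real n - 1) / (real k - 1))"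
proof (intro conjI allI impI)
  fix w :: "'a list"
  show "real (num_kpowers k w) \<le> (real (length w) - real (card (set w))) / (real k - 1)"
    by (rule num_kpowers_bound[OF assms])
next
  fix n :: nat assume n: "n \<ge> 1"
  have "max_num_kpowers TYPE('b) n k \<in> {num_kpowers k w | w :: 'b list. length w = n}"
    unfolding max_num_kpowers_def
    by (rule Max_in[OF finite_num_kpowers_values num_kpowers_values_nonempty])
  then obtain w :: "'b list" where w: "length w = n" "max_num_kpowers TYPE('b) n k = num_kpowers k w"
    by blast
  have "card (set w) \<ge> 1" using w n by (cases w) (auto simp: Suc_le_eq card_gt_0_iff)
  then have "(real (length w) - real (card (set w))) / (real k - 1) \<le> (real n - 1) / (real k - 1)"
    using w assms by (intro divide_right_mono) auto
  then show "real (max_num_kpowers TYPE('b) n k) \<le> (real n - 1) / (real k - 1)"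
    using num_kpowers_bound[OF assms, of w] w by linarith
qed

end
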